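(* Let $m\ge 4$, $k\ge 1$, and let $3\le q_1<q_2<\dots<q_k\le m+1$ be integers. Then the semidirect product $$\mathfrak{r}_m(q_1,\dots,q_k)=\mathfrak{t}_m(q_1,\dots,q_k)\oplus\mathfrak{g}_m(q_1,\dots,q_k)$$ is a solvable and complete Lie algebra.
   Context: All Lie algebras are over $\mathbb{C}$. For $m\ge4$ and integers $3\le q_1<\dots<q_k\le m+1$, $\mathfrak{g}_m(q_1,\dots,q_k)$ is the $(2m+1)$-dimensional nilpotent Lie algebra with Maurer–Cartan equations $d\omega_1=d\omega_2=0$; $d\omega_{q_i}=d\omega_{2m+2-q_i}=0$ for $1\le i\le k$; $d\omega_j=\omega_1\wedge\omega_{j-1}$ for $3\le j\le 2m$ with $j\notin\{q_i,2m+2-q_i\}_{1\le i\le k}$; $d\omega_{2m+1}=\sum_{j=2}^{m}(-1)^j\omega_j\wedge\omega_{2m+1-j}$. Here $d\omega_l=\sum_{i<j}C_{ij}^l\,\omega_i\wedge\omega_j$ means $[X_i,X_j]=\sum_l C_{ij}^l X_l$ in the dual basis $\{X_1,\dots,X_{2m+1}\}$ (the opposite overall sign convention gives an isomorphic algebra). A torus over a nilpotent Lie algebra $\mathfrak{g}$ is an abelian subalgebra of $Der(\mathfrak{g})$ consisting of semisimple derivations; a torus is maximal if it is maximal for inclusion. $\mathfrak{t}_m(q_1,\dots,q_k)$ is the maximal torus over $\mathfrak{g}_m(q_1,\dots,q_k)$ consisting of all derivations that are diagonal in the basis $\{X_1,\dots,X_{2m+1}\}$. In the semidirect product $\mathfrak{t}\oplus\mathfrak{g}$,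 $\mathfrak{t}$ is abelian and acts on $\mathfrak{g}$ by derivations: $[f,x]=f(x)$. A Lie algebra is complete if its center is zero and all its derivations are inner. *)

theory Defs
  imports Complex_Main "HOL-Library.Function_Algebras" "HOL-Library.Product_Plus"
begin

text \<open>Lie algebras live on a subspace \<open>L\<close> of an ambient vector space, so that algebras whose
  dimension depends on a number can be handled uniformly.\<close>

locale lie_algebra = vector_space scale
  for scale :: "'k::field \<Rightarrow> 'a::ab_group_add \<Rightarrow> 'a" (infixr "\<cdot>" 75) +
  fixes L :: "'a set" and br :: "'a \<Rightarrow> 'a \<Rightarrow> 'a"
  assumes subspace_carrier: "subspace L"
    and br_closed: "\<lbrakk>x \<in> L; y \<in> L\<rbrakk> \<Longrightarrow> br x y \<in> L"
    and br_add_left: "\<lbrakk>x \<in> L; y \<in> L; z \<in> L\<rbrakk> \<Longrightarrow> br (x + y) z = br x z + br y z"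
    and br_add_right: "\<lbrakk>x \<in> L; y \<in> L; z \<in> L\<rbrakk> \<Longrightarrow> br x (y + z) = br x y + br x z"
    and br_scale_left: "\<lbrakk>x \<in> L; y \<in> L\<rbrakk> \<Longrightarrow> br (c \<cdot> x) y = c \<cdot> br x y"
    and br_scale_right: "\<lbrakk>x \<in> L; y \<in> L\<rbrakk> \<Longrightarrow> br x (c \<cdot> y) = c \<cdot> br x y"
    and br_self: "x \<in> L \<Longrightarrow> br x x = 0"
    and jacobi: "\<lbrakk>x \<in> L; y \<in> L; z \<in> L\<rbrakk> \<Longrightarrow>
      br x (br y z) + br y (br z x) + br z (br x y) = 0"
begin

primrec derived_series :: "nat \<Rightarrow> 'a set" where
  "derived_series 0 = L"
| "derived_series (Suc n) = span {br x y | x y. x \<in> derived_series n \<and> y \<in> derived_series n}"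

definition solvable :: bool where
  "solvable \<longleftrightarrow> (\<exists>n. derived_series n = {0})"

definition center :: "'a set" where
  "center = {x \<in> L. \<forall>y\<in>L. br x y = 0}"

text \<open>An endomorphism of \<open>L\<close> is represented by the function that is extended by zero outside
  \<open>L\<close>; this makes the representation unique and compatible with pointwise addition, scaling and
  commutators.\<close>

definition Der :: "('a \<Rightarrow> 'a) set" where
  "Der = {D. (\<forall>x. x \<notin> L \<longrightarrow> D x = 0) \<and> (\<forall>x\<in>L. D x \<in> L) \<and>
      (\<forall>x\<in>L. \<forall>y\<in>L. D (x + y) = D x + D y) \<and>
      (\<forall>c. \<forall>x\<in>L. D (c \<cdot> x) = c \<cdot> D x) \<and>
      (\<forall>x\<in>L. \<forall>y\<in>L. D (br x y) = br (D x) y + br x (D y))}"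

definition inner_derivation :: "('a \<Rightarrow> 'a) \<Rightarrow> bool" where
  "inner_derivation D \<longleftrightarrow> D \<in> Der \<and> (\<exists>a\<in>L. \<forall>x\<in>L. D x = br a x)"

definition complete :: bool where
  "complete \<longleftrightarrow> center = {0} \<and> (\<forall>D\<in>Der. inner_derivation D)"

end

text \<open>Semidirect product of a Lie algebra of derivations with the algebra it acts on:
  \<open>[(f, x), (g, y)] = ([f, g], f y - g x + [x, y])\<close> with \<open>[f, g]\<close> the commutator.\<close>

definition sd_scale :: "('k \<Rightarrow> 'a \<Rightarrow> 'a) \<Rightarrow> 'k \<Rightarrow> ('a \<Rightarrow> 'a) \<times> 'a \<Rightarrow> ('a \<Rightarrow> 'a) \<times> 'a" where
  "sd_scale s c p = ((\<lambda>z. s c (fst p z)), s c (snd p))"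

definition sd_bracket ::
  "('a::ab_group_add \<Rightarrow> 'a \<Rightarrow> 'a) \<Rightarrow> ('a \<Rightarrow> 'a) \<times> 'a \<Rightarrow> ('a \<Rightarrow> 'a) \<times> 'a \<Rightarrow> ('a \<Rightarrow> 'a) \<times> 'a" where
  "sd_bracket br p q =
    ((\<lambda>z. fst p (fst q z) - fst q (fst p z)),
     fst p (snd q) - fst q (snd p) + br (snd p) (snd q))"

text \<open>Vectors with coordinates \<open>x 1, \<dots>, x (2m+1)\<close> in the basis \<open>X\<^sub>1, \<dots>, X\<^sub>2\<^sub>m\<^sub>+\<^sub>1\<close> are
  functions that vanish at all other indices.\<close>

type_synonym cvec = "nat \<Rightarrow> complex"

definition vscale :: "complex \<Rightarrow> cvec \<Rightarrow> cvec" where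
  "vscale c x = (\<lambda>i. c * x i)"

definition X_basis :: "nat \<Rightarrow> cvec" where
  "X_basis i = (\<lambda>j. if j = i then 1 else 0)"

definition wedge :: "nat \<Rightarrow> nat \<Rightarrow> cvec \<Rightarrow> cvec \<Rightarrow> complex" where
  "wedge i j x y = x i * y j - x j * y i"

definition broken :: "nat \<Rightarrow> nat \<Rightarrow> (nat \<Rightarrow> nat) \<Rightarrow> nat set" where
  "broken m k q = (\<Union>i\<in>{1..k}. {q i, 2 * m + 2 - q i})"

definition d_omega :: "nat \<Rightarrow> nat \<Rightarrow> (nat \<Rightarrow> nat) \<Rightarrow> nat \<Rightarrow> cvec \<Rightarrow> cvec \<Rightarrow> complex" where
  "d_omega m k q l x y =
    (if 3 \<le> l \<and> l \<le> 2 * m \<and> l \<notin> broken m k q then wedge 1 (l - 1) x y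
     else if l = 2 * m + 1 then (\<Sum>j=2..m. (-1) ^ j * wedge j (2 * m + 1 - j) x y)
     else 0)"

definition g_carrier :: "nat \<Rightarrow> cvec set" where
  "g_carrier m = {x. \<forall>i. i \<notin> {1..2 * m + 1} \<longrightarrow> x i = 0}"

text \<open>If \<open>d\<omega>\<^sub>l\<close> is the sum over \<open>i < j\<close> of the terms \<open>C\<^sub>i\<^sub>j\<^sup>l \<omega>\<^sub>i \<and> \<omega>\<^sub>j\<close>, then the \<open>l\<close>-th coordinate
  \<open>C\<^sub>i\<^sub>j\<^sup>l\<close> of \<open>[X\<^sub>i, X\<^sub>j]\<close> is the value of \<open>d\<omega>\<^sub>l\<close> at \<open>(X\<^sub>i, X\<^sub>j)\<close>. This is the sign convention without
  the minus sign.\<close>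

definition g_bracket :: "nat \<Rightarrow> nat \<Rightarrow> (nat \<Rightarrow> nat) \<Rightarrow> cvec \<Rightarrow> cvec \<Rightarrow> cvec" where
  "g_bracket m k q x y = (\<lambda>l. d_omega m k q l x y)"

text \<open>The maximal torus consisting of all derivations that are diagonal in the basis \<open>X\<^sub>i\<close>.\<close>

definition t_carrier :: "nat \<Rightarrow> nat \<Rightarrow> (nat \<Rightarrow> nat) \<Rightarrow> (cvec \<Rightarrow> cvec) set" where
  "t_carrier m k q =
    {D \<in> lie_algebra.Der vscale (g_carrier m) (g_bracket m k q).
      \<forall>i\<in>{1..2 * m + 1}. \<exists>c. D (X_basis i) = vscale c (X_basis i)}"

definition r_carrier :: "nat \<Rightarrow> nat \<Rightarrow> (nat \<Rightarrow> nat) \<Rightarrow> ((cvec \<Rightarrow> cvec) \<times> cvec) set" where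
  "r_carrier m k q = t_carrier m k q \<times> g_carrier m"

abbreviation r_scale :: "complex \<Rightarrow> (cvec \<Rightarrow> cvec) \<times> cvec \<Rightarrow> (cvec \<Rightarrow> cvec) \<times> cvec" where
  "r_scale \<equiv> sd_scale vscale"

abbreviation r_bracket ::
  "nat \<Rightarrow> nat \<Rightarrow> (nat \<Rightarrow> nat) \<Rightarrow>
    (cvec \<Rightarrow> cvec) \<times> cvec \<Rightarrow> (cvec \<Rightarrow> cvec) \<times> cvec \<Rightarrow> (cvec \<Rightarrow> cvec) \<times> cvec" where
  "r_bracket m k q \<equiv> sd_bracket (g_bracket m k q)"

end

theory Submission
  imports Defs
begin

text \<open>The map \<open>h = diag (1, 2, \<dots>, 2m+1)\<close> is a diagonal derivation with distinct nonzero
  eigenvalues. Given a derivation \<open>D\<close> of the semidirect product, invertibility of \<open>h\<close> on \<open>\<gg>\<close> allows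
  one to subtract an inner derivation so that \<open>D (h, 0)\<close> lies in the torus. Then each \<open>D (0, X\<^sub>i)\<close> is
  an eigenvector of \<open>h\<close> for the eigenvalue \<open>i\<close>, hence a multiple of \<open>X\<^sub>i\<close>. It follows that \<open>D\<close>
  vanishes on the torus and acts on \<open>\<gg>\<close> as a diagonal derivation, which is itself an element of the
  torus. The same \<open>h\<close> shows that the center is zero, and its grading bounds the derived series.\<close>

section \<open>Derivations and semidirect products\<close>

context lie_algebra
begin

section \<open>Elementary bracket identities\<close>

lemma zero_mem: "0 \<in> L"
  using subspace_carrier subspace_0 by blast

lemma br_zero_left: "x \<in> L \<Longrightarrow> br 0 x = 0"
  using br_scale_left[of 0 x 0] zero_mem by simp

lemma br_zero_right: "x \<in> L \<Longrightarrow> br x 0 = 0"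
  using br_scale_right[of x 0 0] zero_mem by simp

lemma add_mem: "x \<in> L \<Longrightarrow> y \<in> L \<Longrightarrow> x + y \<in> L"
  using subspace_carrier subspace_add by blast

lemma scale_mem: "x \<in> L \<Longrightarrow> c \<cdot> x \<in> L"
  using subspace_carrier subspace_scale by blast

lemma uminus_mem: "x \<in> L \<Longrightarrow> - x \<in> L"
  using subspace_carrier subspace_neg by blast

lemma diff_mem: "x \<in> L \<Longrightarrow> y \<in> L \<Longrightarrow> x - y \<in> L"
  using subspace_carrier subspace_diff by blast

lemma br_uminus_left: "x \<in> L \<Longrightarrow> y \<in> L \<Longrightarrow> br (- x) y = - br x y"
  using br_scale_left[of x y "-1"] by simp

lemma br_uminus_right: "x \<in> L \<Longrightarrow> y \<in> L \<Longrightarrow> br x (- y) = - br x y"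
  using br_scale_right[of x y "-1"] by simp

lemma br_diff_left: "x \<in> L \<Longrightarrow> y \<in> L \<Longrightarrow> z \<in> L \<Longrightarrow> br (x - y) z = br x z - br y z"
  using br_add_left[of x "- y" z] by (simp add: br_uminus_left uminus_mem)

lemma br_diff_right: "x \<in> L \<Longrightarrow> y \<in> L \<Longrightarrow> z \<in> L \<Longrightarrow> br x (y - z) = br x y - br x z"
  using br_add_right[of x y "- z"] by (simp add: br_uminus_right uminus_mem)

lemma br_skew:
  assumes "x \<in> L" "y \<in> L" shows "br x y = - br y x"
proof -
  have "br (x + y) (x + y) = br x x + br y x + (br x y + br y y)"
    using assms by (simp only: br_add_left br_add_right add_mem)
  then have "br x y + br y x = 0"
    using assms by (simp add: br_self add_mem add.commute)
  then show ?thesis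
    by (simp only: eq_neg_iff_add_eq_0)
qed

lemma jacobi_solved:
  assumes "x \<in> L" "y \<in> L" "z \<in> L"
  shows "br x (br y z) = - br y (br z x) - br z (br x y)"
proof -
  have "br x (br y z) = - (br y (br z x) + br z (br x y))"
    using jacobi[OF assms] by (simp only: eq_neg_iff_add_eq_0 add.assoc)
  then show ?thesis by simp
qed

section \<open>The space of derivations\<close>

lemma DerI:
  assumes "\<And>x. x \<notin> L \<Longrightarrow> D x = 0" and "\<And>x. x \<in> L \<Longrightarrow> D x \<in> L"
    and "\<And>x y. x \<in> L \<Longrightarrow> y \<in> L \<Longrightarrow> D (x + y) = D x + D y"
    and "\<And>c x. x \<in> L \<Longrightarrow> D (c \<cdot> x) = c \<cdot> D x"
    and "\<And>x y. x \<in> L \<Longrightarrow> y \<in> L \<Longrightarrow> D (br x y) = br (D x) y + br x (D y)"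
  shows "D \<in> Der"
  using assms unfolding Der_def by blast

lemma DerD:
  assumes "D \<in> Der"
  shows Der_outside: "x \<notin> L \<Longrightarrow> D x = 0" and Der_mem: "x \<in> L \<Longrightarrow> D x \<in> L"
    and Der_add: "x \<in> L \<Longrightarrow> y \<in> L \<Longrightarrow> D (x + y) = D x + D y"
    and Der_scale: "x \<in> L \<Longrightarrow> D (c \<cdot> x) = c \<cdot> D x"
    and Der_br: "x \<in> L \<Longrightarrow> y \<in> L \<Longrightarrow> D (br x y) = br (D x) y + br x (D y)"
  using assms unfolding Der_def by blast+

lemma Der_0: "D \<in> Der \<Longrightarrow> D 0 = 0"
  using Der_scale[of D 0 0] zero_mem by simp

lemma Der_diff:
  assumes "D \<in> Der" "x \<in> L" "y \<in> L" shows "D (x - y) = D x - D y"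
  using Der_add[OF assms(1), of x "- y"] Der_scale[OF assms(1), of y "-1"] assms
  by (simp add: uminus_mem)

lemma zero_in_Der: "0 \<in> Der"
  by (rule DerI) (auto simp: zero_mem br_zero_left br_zero_right)

lemma add_in_Der:
  assumes "D \<in> Der" "E \<in> Der" shows "D + E \<in> Der"
  by (rule DerI) (use assms in \<open>auto simp: DerD add_mem scale_right_distrib br_add_left br_add_right
    algebra_simps\<close>)

lemma scale_in_Der:
  assumes "D \<in> Der" shows "(\<lambda>x. c \<cdot> D x) \<in> Der"
  by (rule DerI) (use assms in \<open>auto simp: DerD scale_mem scale_right_distrib br_scale_left
    br_scale_right scale_left_commute\<close>)

lemma diff_in_Der:
  assumes "D \<in> Der" "E \<in> Der" shows "(\<lambda>x. D x - E x) \<in> Der"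
proof -
  have "(\<lambda>x. D x - E x) = D + (\<lambda>x. (-1) \<cdot> E x)"
    by (auto simp: fun_eq_iff)
  then show ?thesis
    using add_in_Der[OF assms(1) scale_in_Der[OF assms(2), of "-1"]] by simp
qed

text \<open>The Leibniz rule for \<open>br a\<close> is the Jacobi identity; the cut-off outside
  \<open>L\<close> matches the encoding of \<open>Der\<close>.\<close>

lemma ad_in_Der:
  assumes "a \<in> L" shows "(\<lambda>x. if x \<in> L then br a x else 0) \<in> Der"
proof (rule DerI, goal_cases)
  case (5 x y)
  have "br x (br y a) = - br x (br a y)" "br y (br a x) = - br (br a x) y"
    "br a (br x y) = - br x (br y a) - br y (br a x)"
    using 5 assms jacobi_solved[of a x y] br_skew[of y a] br_skew[of y "br a x"]
    by (simp_all add: br_closed br_uminus_right)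
  then show ?case
    using 5 by (simp add: br_closed)
qed (use assms in \<open>auto simp: br_closed br_add_right br_scale_right add_mem scale_mem\<close>)

lemma inner_derivationI:
  assumes "D \<in> Der" "a \<in> L" "\<And>x. x \<in> L \<Longrightarrow> D x = br a x"
  shows "inner_derivation D"
  using assms unfolding inner_derivation_def by blast

text \<open>The first component of the Jacobi identity is that of commutators of maps. In the
  second, the Leibniz rule for members of \<open>T\<close> cancels the mixed terms and leaves the
  Jacobi identity in \<open>L\<close>.\<close>

lemma semidirect_lie_algebra:
  assumes T: "T \<subseteq> Der" and T0: "0 \<in> T"
    and Tadd: "\<And>f g. f \<in> T \<Longrightarrow> g \<in> T \<Longrightarrow> f + g \<in> T"
    and Tscale: "\<And>c f. f \<in> T \<Longrightarrow> (\<lambda>x. c \<cdot> f x) \<in> T"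
    and Tcomm: "\<And>f g. f \<in> T \<Longrightarrow> g \<in> T \<Longrightarrow> (\<lambda>x. f (g x) - g (f x)) \<in> T"
  shows "lie_algebra (sd_scale scale) (T \<times> L) (sd_bracket br)"
proof -
  have vs: "vector_space (sd_scale scale)"
    by unfold_locales
      (auto simp: sd_scale_def fun_eq_iff scale_left_distrib scale_right_distrib)
  then interpret sd: vector_space "sd_scale scale" .
  have D: "f \<in> Der" if "f \<in> T" for f using T that by blast
  \<comment> \<open>No restriction on \<open>x\<close>: outside \<open>L\<close> the value is 0,
    which lies in \<open>L\<close>. Identities between maps can thus be checked at every ambient
    vector.\<close>
  have mem: "f x \<in> L" if "f \<in> T" for f x
    using Der_mem Der_outside D that zero_mem by (metis (full_types))
  have add: "f (x + y) = f x + f y" "f (x - y) = f x - f y" if "f \<in> T" "x \<in> L" "y \<in> L" for f x y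
    using that D Der_add Der_diff by auto
  have scl: "f (c \<cdot> x) = c \<cdot> f x" if "f \<in> T" "x \<in> L" for f c x
    using that D Der_scale by auto
  have brk: "f (br x y) = br (f x) y + br x (f y)" if "f \<in> T" "x \<in> L" "y \<in> L" for f x y
    using that D Der_br by auto
  note simps = sd_bracket_def mem add scl brk add_mem diff_mem scale_mem br_closed br_add_left
    br_add_right br_diff_left br_diff_right br_scale_left br_scale_right
  show ?thesis
  proof (unfold_locales, goal_cases)
    case 1
    show ?case
      using T0 Tadd Tscale
      by (auto simp: sd.subspace_def sd_scale_def zero_prod_def plus_prod_def zero_mem add_mem scale_mem)
  next
    case (2 x y)
    then show ?case by (auto simp: simps Tcomm)
  next
    case (3 x y z)
    then show ?case by (cases x; cases y; cases z) (auto simp: simps fun_eq_iff)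
  next
    case (4 x y z)
    then show ?case by (cases x; cases y; cases z) (auto simp: simps fun_eq_iff)
  next
    case (5 x y c)
    then show ?case
      by (cases x; cases y) (auto simp: simps sd_scale_def fun_eq_iff scale_right_diff_distrib scale_right_distrib)
  next
    case (6 x y c)
    then show ?case
      by (cases x; cases y) (auto simp: simps sd_scale_def fun_eq_iff scale_right_diff_distrib scale_right_distrib)
  next
    case (7 x)
    then show ?case by (cases x) (auto simp: simps br_self zero_prod_def fun_eq_iff)
  next
    case (8 x y z)
    obtain f u g v h w where xyz: "x = (f, u)" "y = (g, v)" "z = (h, w)"
      by (cases x; cases y; cases z)
    have in_T: "f \<in> T" "g \<in> T" "h \<in> T" and in_L: "u \<in> L" "v \<in> L" "w \<in> L"
      using 8 xyz by auto
    \<comment> \<open>Orient the mixed brackets with the derived vector on the right, so that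
      cancelling terms become syntactically opposite.\<close>
    have skew: "br (f w) v = - br v (f w)" "br (g u) w = - br w (g u)" "br (h v) u = - br u (h v)"
      "br (f v) w = - br w (f v)" "br (g w) u = - br u (g w)" "br (h u) v = - br v (h u)"
      by (blast intro: br_skew mem in_T in_L)+
    have jac: "br u (br v w) = - br v (br w u) - br w (br u v)"
      by (rule jacobi_solved[OF in_L])
    have fst_eq: "f (g (h t) - h (g t)) - (g (h (f t)) - h (g (f t)))
      + (g (h (f t) - f (h t)) - (h (f (g t)) - f (h (g t))))
      + (h (f (g t) - g (f t)) - (f (g (h t)) - g (f (h t)))) = 0" for t
      using in_T by (simp add: add(2) mem)
    \<comment> \<open>One cyclic summand with the Leibniz rule applied, to be instantiated at all
      three rotations.\<close>
    have expand: "f' (g' c - h' b + br b c) - (g' (h' a) - h' (g' a)) + br a (g' c - h' b + br b c)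
      = f' (g' c) - f' (h' b) + (br (f' b) c + br b (f' c)) - (g' (h' a) - h' (g' a))
        + (br a (g' c) - br a (h' b) + br a (br b c))"
      if "f' \<in> T" "g' \<in> T" "h' \<in> T" "a \<in> L" "b \<in> L" "c \<in> L" for f' g' h' a b c
      using that by (simp add: add brk mem br_closed diff_mem add_mem br_add_right br_diff_right)
    have snd_eq: "f (g w - h v + br v w) - (g (h u) - h (g u)) + br u (g w - h v + br v w)
      + (g (h u - f w + br w u) - (h (f v) - f (h v)) + br v (h u - f w + br w u))
      + (h (f v - g u + br u v) - (f (g w) - g (f w)) + br w (f v - g u + br u v)) = 0"
      unfolding expand[OF in_T in_L] expand[OF in_T(2,3,1) in_L(2,3,1)]
        expand[OF in_T(3,1,2) in_L(3,1,2)] skew jac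
      by (simp add: algebra_simps)
    show ?case
      using fst_eq snd_eq by (simp add: xyz sd_bracket_def zero_prod_def fun_eq_iff)
  qed
qed

end

section \<open>The algebra \<open>\<gg>\<close>\<close>

text \<open>The coefficient of \<open>wedge 1 (l - 1)\<close> in \<open>d_omega\<close> for
  \<open>l \<le> 2m\<close>; as a 0/1 factor it absorbs the case distinction on broken
  indices.\<close>

definition structure_const :: "nat \<Rightarrow> nat \<Rightarrow> (nat \<Rightarrow> nat) \<Rightarrow> nat \<Rightarrow> complex" where
  "structure_const m k q l = (if 3 \<le> l \<and> l \<le> 2 * m \<and> l \<notin> broken m k q then 1 else 0)"

text \<open>\<open>broken\<close> is a union of pairs exchanged by the reflection, which also
  preserves the range from 3 to \<open>2m - 1\<close>. The bounds on \<open>q\<close> keep the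
  natural subtraction exact.\<close>

lemma structure_const_reflect:
  assumes "\<forall>i\<in>{1..k}. 3 \<le> q i \<and> q i \<le> m + 1" and "3 \<le> l" and "l \<le> 2 * m - 1"
  shows "structure_const m k q (2 * m + 2 - l) = structure_const m k q l"
proof -
  have "2 * m + 2 - l \<in> broken m k q \<longleftrightarrow> l \<in> broken m k q"
    unfolding broken_def
  proof (intro iffI; elim UN_E)
    fix i assume i: "i \<in> {1..k}" "2 * m + 2 - l \<in> {q i, 2 * m + 2 - q i}"
    moreover have "3 \<le> q i" "q i \<le> m + 1" using assms(1) i(1) by auto
    ultimately have "l \<in> {q i, 2 * m + 2 - q i}" using assms(2,3) by auto
    then show "l \<in> (\<Union>i\<in>{1..k}. {q i, 2 * m + 2 - q i})" using i(1) by blast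
  next
    fix i assume i: "i \<in> {1..k}" "l \<in> {q i, 2 * m + 2 - q i}"
    moreover have "3 \<le> q i" "q i \<le> m + 1" using assms(1) i(1) by auto
    ultimately have "2 * m + 2 - l \<in> {q i, 2 * m + 2 - q i}" using assms(2,3) by auto
    then show "2 * m + 2 - l \<in> (\<Union>i\<in>{1..k}. {q i, 2 * m + 2 - q i})" using i(1) by blast
  qed
  then show ?thesis
    using assms(2,3) unfolding structure_const_def by auto
qed

section \<open>Coordinates of the bracket and the Jacobi identity\<close>

lemma g_bracket_low:
  "l \<le> 2 * m \<Longrightarrow> g_bracket m k q x y l = structure_const m k q l * wedge 1 (l - 1) x y"
  by (auto simp: g_bracket_def d_omega_def structure_const_def)

lemma g_bracket_last:
  "g_bracket m k q x y (Suc (2 * m)) = (\<Sum>j=2..m. (-1) ^ j * wedge j (2 * m + 1 - j) x y)"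
  by (auto simp: g_bracket_def d_omega_def)

lemma g_bracket_high: "Suc (2 * m) < l \<Longrightarrow> g_bracket m k q x y l = 0"
  by (auto simp: g_bracket_def d_omega_def)

lemma g_bracket_1: "g_bracket m k q x y (Suc 0) = 0"
  by (auto simp: g_bracket_def d_omega_def)

lemma index_cases:
  obtains "l \<le> 2 * m" | "l = Suc (2 * m)" | "Suc (2 * m) < (l::nat)"
  by linarith

text \<open>The sum telescopes because the broken indices are symmetric under \<open>l \<mapsto> 2m + 2 - l\<close>.\<close>

lemma g_jacobi_last:
  assumes q: "\<forall>i\<in>{1..k}. 3 \<le> q i \<and> q i \<le> m + 1" and "2 \<le> m"
  defines "b \<equiv> g_bracket m k q"
  shows "(b x (b y z) + b y (b z x) + b z (b x y)) (Suc (2 * m)) = 0"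
proof -
  define e where "e = structure_const m k q"
  \<comment> \<open>\<open>T j\<close> is the determinant of the columns \<open>j\<close>, 1,
    \<open>2m - j\<close> of the matrix with rows \<open>x\<close>, \<open>y\<close>,
    \<open>z\<close>.\<close>
  define T where "T j = x j * wedge 1 (2 * m - j) y z + y j * wedge 1 (2 * m - j) z x
    + z j * wedge 1 (2 * m - j) x y" for j
  define F where "F j = (-1) ^ j * e (j + 1) * T j" for j
  have summand: "(-1) ^ j * (wedge j (2 * m + 1 - j) x (b y z) + wedge j (2 * m + 1 - j) y (b z x)
      + wedge j (2 * m + 1 - j) z (b x y)) = F j - F (j - 1)" if j: "2 \<le> j" "j \<le> m" for j
  proof -
    have e: "e (2 * m + 1 - j) = e (j + 1)"
      using structure_const_reflect[OF q, of "j + 1"] j unfolding e_def by simp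
    \<comment> \<open>These are the columns of \<open>T (j - 1)\<close> with the outer two swapped,
      hence the sign.\<close>
    have T': "x (2 * m + 1 - j) * wedge 1 (j - 1) y z + y (2 * m + 1 - j) * wedge 1 (j - 1) z x
        + z (2 * m + 1 - j) * wedge 1 (j - 1) x y = - T (j - 1)"
    proof -
      have "2 * m - (j - 1) = 2 * m + 1 - j" using j by simp
      then show ?thesis unfolding T_def wedge_def by (simp add: algebra_simps)
    qed
    have b1: "b u v j = e j * wedge 1 (j - 1) u v" for u v
      using j unfolding b_def e_def by (intro g_bracket_low) auto
    have b2: "b u v (2 * m + 1 - j) = e (j + 1) * wedge 1 (2 * m - j) u v" for u v
      using j g_bracket_low[of "2 * m + 1 - j" m k q u v] e unfolding b_def e_def by simp
    have s: "(-1) ^ (j - 1) = - ((-1::complex) ^ j)"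
      using j by (cases j) auto
    have "wedge j (2 * m + 1 - j) x (b y z) + wedge j (2 * m + 1 - j) y (b z x)
      + wedge j (2 * m + 1 - j) z (b x y) = e (j + 1) * T j
       - e j * (x (2 * m + 1 - j) * wedge 1 (j - 1) y z + y (2 * m + 1 - j) * wedge 1 (j - 1) z x
        + z (2 * m + 1 - j) * wedge 1 (j - 1) x y)"
      unfolding wedge_def[of j] b1 b2 T_def by (simp add: algebra_simps)
    then show ?thesis
      unfolding T' F_def s using j by (simp add: algebra_simps)
  qed
  have "(b x (b y z) + b y (b z x) + b z (b x y)) (Suc (2 * m))
     = (\<Sum>j=2..m. (-1) ^ j * (wedge j (2 * m + 1 - j) x (b y z) + wedge j (2 * m + 1 - j) y (b z x)
      + wedge j (2 * m + 1 - j) z (b x y)))"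
    unfolding b_def by (simp add: g_bracket_last sum.distrib distrib_left)
  also have "\<dots> = (\<Sum>j=Suc 1..m. F j - F (j - 1))"
    using summand by (intro sum.cong) auto
  also have "\<dots> = F m - F 1"
    using sum_telescope''[of 1 m F] assms(2) by simp
  \<comment> \<open>The coefficient at index 2 is 0, as \<open>d\<omega>\<^sub>2\<close>
    vanishes.\<close>
  also have "F 1 = 0"
    by (simp add: F_def e_def structure_const_def)
  \<comment> \<open>For \<open>j = m\<close> the determinant has two equal columns.\<close>
  also have "F m = 0"
    by (simp add: F_def T_def wedge_def algebra_simps)
  finally show ?thesis by simp
qed

text \<open>In coordinates \<open>l \<le> 2m\<close> an inner bracket enters only through its
  coordinate \<open>l - 1\<close>, because its first coordinate is 0. The cyclic sum is then a
  determinant with column 1 repeated.\<close>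

lemma g_jacobi:
  assumes "\<forall>i\<in>{1..k}. 3 \<le> q i \<and> q i \<le> m + 1" and "2 \<le> m"
  defines "b \<equiv> g_bracket m k q"
  shows "b x (b y z) + b y (b z x) + b z (b x y) = 0"
proof
  fix l
  show "(b x (b y z) + b y (b z x) + b z (b x y)) l = 0 l"
  proof (cases rule: index_cases[of l m])
    case 1
    then show ?thesis
      unfolding b_def by (simp add: g_bracket_low g_bracket_1 wedge_def algebra_simps)
  next
    case 2
    then show ?thesis using g_jacobi_last[OF assms(1,2), of x y z] unfolding b_def by simp
  next
    case 3
    then show ?thesis unfolding b_def by (simp add: g_bracket_high)
  qed
qed

section \<open>Bilinearity and induction over the basis\<close>

lemma vscale_apply: "vscale c x i = c * x i"
  by (simp add: vscale_def)

lemma vector_space_vscale: "vector_space vscale"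
  by unfold_locales (auto simp: vscale_def fun_eq_iff algebra_simps)

lemma wedge_linear:
  "wedge i j (x + y) z = wedge i j x z + wedge i j y z"
  "wedge i j x (y + z) = wedge i j x y + wedge i j x z"
  "wedge i j (vscale c x) y = c * wedge i j x y"
  "wedge i j x (vscale c y) = c * wedge i j x y"
  "wedge i j x x = 0"
  by (auto simp: wedge_def vscale_def algebra_simps)

lemma g_bracket_linear:
  "g_bracket m k q (x + y) z = g_bracket m k q x z + g_bracket m k q y z"
  "g_bracket m k q x (y + z) = g_bracket m k q x y + g_bracket m k q x z"
  "g_bracket m k q (vscale c x) y = vscale c (g_bracket m k q x y)"
  "g_bracket m k q x (vscale c y) = vscale c (g_bracket m k q x y)"
  "g_bracket m k q x x = 0"
  by (simp_all add: g_bracket_def d_omega_def fun_eq_iff vscale_apply wedge_linear distrib_left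
    sum.distrib sum_distrib_left mult.left_commute)

lemma g_lie_algebra:
  assumes "\<forall>i\<in>{1..k}. 3 \<le> q i \<and> q i \<le> m + 1" and "2 \<le> m"
  shows "lie_algebra vscale (g_carrier m) (g_bracket m k q)"
proof -
  interpret vector_space vscale by (rule vector_space_vscale)
  show ?thesis
  proof (unfold_locales, goal_cases)
    case 1
    show ?case by (auto simp: subspace_def g_carrier_def vscale_def)
  next
    case 2
    show ?case using assms(2) by (auto simp: g_carrier_def g_bracket_def d_omega_def)
  qed (auto simp: g_bracket_linear g_jacobi[OF assms])
qed

lemma X_basis_in_g: "i \<in> {1..2 * m + 1} \<Longrightarrow> X_basis i \<in> g_carrier m"
  by (auto simp: g_carrier_def X_basis_def)

text \<open>Each vector is a finite sum of multiples of basis vectors, so identities between linear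
  maps reduce to the \<open>X_basis i\<close>.\<close>

lemma g_carrier_induct [consumes 1, case_names zero basis add]:
  assumes "x \<in> g_carrier m" and "P 0"
    and basis: "\<And>c i. i \<in> {1..2 * m + 1} \<Longrightarrow> P (vscale c (X_basis i))"
    and add: "\<And>x y. x \<in> g_carrier m \<Longrightarrow> y \<in> g_carrier m \<Longrightarrow> P x \<Longrightarrow> P y \<Longrightarrow> P (x + y)"
  shows "P x"
proof -
  \<comment> \<open>Induction on a bound \<open>n\<close> for the support; membership is carried
    along because \<open>add\<close> asks for it.\<close>
  have "x \<in> g_carrier m \<and> P x" if "n \<le> 2 * m + 1" "\<And>i. i \<notin> {1..n} \<Longrightarrow> x i = 0" for n x
    using that
  proof (induction n arbitrary: x)
    case 0
    then have "x = 0" by (auto simp: fun_eq_iff)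
    moreover have "0 \<in> g_carrier m" by (simp add: g_carrier_def)
    ultimately show ?case using assms(2) by blast
  next
    case (Suc n)
    define y where "y = (\<lambda>i. if i = Suc n then 0 else x i)"
    have "y \<in> g_carrier m \<and> P y"
      using Suc.prems by (intro Suc.IH) (auto simp: y_def)
    moreover have "vscale (x (Suc n)) (X_basis (Suc n)) \<in> g_carrier m"
      using Suc.prems(1) by (auto simp: g_carrier_def vscale_def X_basis_def)
    moreover have "x = y + vscale (x (Suc n)) (X_basis (Suc n))"
      by (auto simp: y_def vscale_def X_basis_def fun_eq_iff)
    moreover have "x \<in> g_carrier m"
      using Suc.prems by (auto simp: g_carrier_def)
    ultimately show ?case
      using add basis[of "Suc n"] Suc.prems(1) by (metis atLeastAtMost_iff le_add1 plus_1_eq_Suc)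
  qed
  from this[of "2 * m + 1" x] show ?thesis
    using assms(1) by (auto simp: g_carrier_def)
qed

section \<open>Diagonal derivations\<close>

text \<open>Zero outside the carrier, as \<open>Der\<close> requires, so that a derivation can equal
  it as a function.\<close>

definition diag_map :: "nat \<Rightarrow> (nat \<Rightarrow> complex) \<Rightarrow> cvec \<Rightarrow> cvec" where
  "diag_map m c x = (if x \<in> g_carrier m then (\<lambda>i. c i * x i) else 0)"

lemma diag_map_apply: "x \<in> g_carrier m \<Longrightarrow> diag_map m c x i = c i * x i"
  by (simp add: diag_map_def)

lemma diag_map_basis: "i \<in> {1..2 * m + 1} \<Longrightarrow> diag_map m c (X_basis i) = vscale (c i) (X_basis i)"
  by (auto simp: diag_map_apply X_basis_in_g fun_eq_iff vscale_apply) (auto simp: X_basis_def)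

lemma diag_map_zero: "diag_map m c 0 = 0"
  by (auto simp: diag_map_def fun_eq_iff)

lemma diag_map_add:
  "x \<in> g_carrier m \<Longrightarrow> y \<in> g_carrier m \<Longrightarrow> diag_map m c (x + y) = diag_map m c x + diag_map m c y"
  by (auto simp: diag_map_def g_carrier_def fun_eq_iff algebra_simps)

lemma diag_map_mem: "diag_map m c x \<in> g_carrier m"
  by (auto simp: diag_map_def g_carrier_def)

lemma diag_map_commute: "diag_map m c (diag_map m d x) = diag_map m d (diag_map m c x)"
  using diag_map_mem[of m c x] diag_map_mem[of m d x]
  by (auto simp: diag_map_def fun_eq_iff)

lemma diag_map_in_t_carrier:
  assumes "lie_algebra vscale (g_carrier m) (g_bracket m k q)"
    and der: "\<And>x y. x \<in> g_carrier m \<Longrightarrow> y \<in> g_carrier m \<Longrightarrow>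
      diag_map m c (g_bracket m k q x y)
      = g_bracket m k q (diag_map m c x) y + g_bracket m k q x (diag_map m c y)"
  shows "diag_map m c \<in> t_carrier m k q"
proof -
  interpret g: lie_algebra vscale "g_carrier m" "g_bracket m k q" by fact
  have "diag_map m c \<in> g.Der"
  proof (rule g.DerI, goal_cases)
    case (3 x y)
    then show ?case by (rule diag_map_add)
  next
    case (4 a x)
    then show ?case using g.scale_mem by (auto simp: diag_map_def fun_eq_iff vscale_def)
  qed (auto simp: der diag_map_mem, auto simp: diag_map_def)
  then show ?thesis
    using diag_map_basis unfolding t_carrier_def by blast
qed

text \<open>By linearity a derivation is determined on the basis, so a torus element amounts to a
  list of eigenvalues and computations become coordinatewise.\<close>

lemma t_carrier_obtain_diag:
  assumes "lie_algebra vscale (g_carrier m) (g_bracket m k q)" and f: "f \<in> t_carrier m k q"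
  obtains c where "f = diag_map m c"
proof -
  interpret g: lie_algebra vscale "g_carrier m" "g_bracket m k q" by fact
  have Der: "f \<in> g.Der" using f unfolding t_carrier_def by blast
  have "\<forall>i\<in>{1..2 * m + 1}. \<exists>c. f (X_basis i) = vscale c (X_basis i)"
    using f unfolding t_carrier_def by blast
  then obtain c where c: "\<And>i. i \<in> {1..2 * m + 1} \<Longrightarrow> f (X_basis i) = vscale (c i) (X_basis i)"
    by metis
  have "f x = diag_map m c x" for x
  proof (cases "x \<in> g_carrier m")
    case True
    then show ?thesis
    proof (induction rule: g_carrier_induct)
      case zero
      show ?case using g.Der_0[OF Der] diag_map_zero by metis
    next
      case (basis a i)
      then have "f (vscale a (X_basis i)) = vscale a (vscale (c i) (X_basis i))"
        using g.Der_scale[OF Der] X_basis_in_g c by metis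
      then show ?case
        using basis g.scale_mem X_basis_in_g
        by (auto simp: diag_map_def fun_eq_iff vscale_def X_basis_def)
    next
      case (add x y)
      then show ?case using g.Der_add[OF Der] diag_map_add by metis
    qed
  qed (simp add: diag_map_def g.Der_outside[OF Der])
  then show ?thesis using that by blast
qed

section \<open>Commutativity of the torus and the grading derivation\<close>

lemma t_carrier_commute:
  assumes "lie_algebra vscale (g_carrier m) (g_bracket m k q)"
    and "f \<in> t_carrier m k q" "g \<in> t_carrier m k q"
  shows "f (g x) = g (f x)"
  using t_carrier_obtain_diag[OF assms(1,2)] t_carrier_obtain_diag[OF assms(1,3)]
  by (metis diag_map_commute)

lemma r_lie_algebra:
  assumes "lie_algebra vscale (g_carrier m) (g_bracket m k q)"
  shows "lie_algebra r_scale (r_carrier m k q) (r_bracket m k q)"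
proof -
  interpret g: lie_algebra vscale "g_carrier m" "g_bracket m k q" by fact
  have zero: "0 \<in> t_carrier m k q"
    using g.zero_in_Der unfolding t_carrier_def
    by (auto intro!: exI[of _ 0] simp: vscale_def)
  show ?thesis
    unfolding r_carrier_def
  proof (rule g.semidirect_lie_algebra)
    show "t_carrier m k q \<subseteq> g.Der" unfolding t_carrier_def by blast
  next
    fix f g assume fg: "f \<in> t_carrier m k q" "g \<in> t_carrier m k q"
    have "\<exists>c. (f + g) (X_basis i) = vscale c (X_basis i)" if i: "i \<in> {1..2 * m + 1}" for i
    proof -
      obtain c d where "f (X_basis i) = vscale c (X_basis i)" "g (X_basis i) = vscale d (X_basis i)"
        using fg i unfolding t_carrier_def by blast
      then have "(f + g) (X_basis i) = vscale (c + d) (X_basis i)"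
        by (simp add: g.scale_left_distrib)
      then show ?thesis by blast
    qed
    then show "f + g \<in> t_carrier m k q"
      using fg g.add_in_Der unfolding t_carrier_def by blast
    \<comment> \<open>The torus is abelian, so closure under commutators only asks for the zero
      map.\<close>
    have "(\<lambda>x. f (g x) - g (f x)) = 0"
      using t_carrier_commute[OF assms fg] by (simp add: fun_eq_iff)
    then show "(\<lambda>x. f (g x) - g (f x)) \<in> t_carrier m k q"
      using zero by simp
  next
    fix a f assume f: "f \<in> t_carrier m k q"
    have "\<exists>c. vscale a (f (X_basis i)) = vscale c (X_basis i)" if i: "i \<in> {1..2 * m + 1}" for i
    proof -
      obtain c where "f (X_basis i) = vscale c (X_basis i)"
        using f i unfolding t_carrier_def by blast
      then have "vscale a (f (X_basis i)) = vscale (a * c) (X_basis i)" by simp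
      then show ?thesis by blast
    qed
    then show "(\<lambda>x. vscale a (f x)) \<in> t_carrier m k q"
      using f g.scale_in_Der unfolding t_carrier_def by blast
  qed (rule zero)
qed

text \<open>Weights add: indices 1 and \<open>l - 1\<close> bracket into index \<open>l\<close>, and
  \<open>j\<close> and \<open>2m + 1 - j\<close> into \<open>2m + 1\<close>. Broken indices only
  delete brackets, so weight \<open>i\<close> on \<open>X_basis i\<close> is compatible with every
  \<open>q\<close>.\<close>

lemma grading_in_t_carrier:
  assumes "lie_algebra vscale (g_carrier m) (g_bracket m k q)"
  shows "diag_map m of_nat \<in> t_carrier m k q"
proof (rule diag_map_in_t_carrier[OF assms])
  interpret g: lie_algebra vscale "g_carrier m" "g_bracket m k q" by fact
  fix x y assume x: "x \<in> g_carrier m" and y: "y \<in> g_carrier m"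
  let ?h = "diag_map m of_nat" and ?b = "g_bracket m k q"
  show "?h (?b x y) = ?b (?h x) y + ?b x (?h y)"
  proof
    fix l
    have *: "?h (?b x y) l = of_nat l * ?b x y l"
      using g.br_closed[OF x y] by (simp add: diag_map_apply)
    show "?h (?b x y) l = (?b (?h x) y + ?b x (?h y)) l"
    proof (cases rule: index_cases[of l m])
      case 1
      show ?thesis
      proof (cases "l = 0")
        case False
        \<comment> \<open>Fails at \<open>l = 0\<close>, where \<open>l - 1\<close> truncates; there
          the coefficient vanishes instead.\<close>
        then have "of_nat l = 1 + (of_nat (l - 1) :: complex)" by (cases l) auto
        then show ?thesis
          unfolding * plus_fun_apply g_bracket_low[OF 1] wedge_def
            diag_map_apply[OF x] diag_map_apply[OF y] of_nat_1
          by algebra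
      next
        case True
        show ?thesis
          unfolding * by (simp add: True g_bracket_low structure_const_def)
      qed
    next
      case 2
      have "of_nat (Suc (2 * m)) * ((-1) ^ j * wedge j (2 * m + 1 - j) x y) =
        (-1) ^ j * wedge j (2 * m + 1 - j) (?h x) y + (-1) ^ j * wedge j (2 * m + 1 - j) x (?h y)"
        if "j \<in> {2..m}" for j
      proof -
        have "of_nat (Suc (2 * m)) = of_nat j + (of_nat (2 * m + 1 - j) :: complex)"
          unfolding of_nat_add[symmetric] using that by (intro arg_cong[of _ _ of_nat]) simp
        then show ?thesis
          by (simp only: wedge_def diag_map_apply[OF x] diag_map_apply[OF y]) (simp only: algebra_simps)
      qed
      then show ?thesis
        unfolding * unfolding 2 plus_fun_apply g_bracket_last sum_distrib_left
          sum.distrib[symmetric]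
        by (intro sum.cong) auto
    next
      case 3
      then show ?thesis unfolding * by (simp add: g_bracket_high)
    qed
  qed
qed

section \<open>The semidirect product\<close>

text \<open>A bracket of weights \<open>i\<close> and \<open>j\<close> has weight
  \<open>i + j\<close>; if both are at least \<open>a \<ge> 1\<close>, the sum is at least
  \<open>a + 1\<close>.\<close>

lemma g_bracket_filtration:
  assumes "\<And>i. i < a \<Longrightarrow> x i = 0" "\<And>i. i < a \<Longrightarrow> y i = 0" and "1 \<le> a" and "l < Suc a"
  shows "g_bracket m k q x y l = 0"
proof (cases rule: index_cases[of l m])
  case 1
  then show ?thesis
  proof (cases "l \<le> 2")
    case False
    then have "x 1 = 0" "y 1 = 0" using assms by auto
    then show ?thesis using 1 by (simp add: g_bracket_low wedge_def)
  qed (simp add: g_bracket_low structure_const_def)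
next
  case 2
  have "wedge j (2 * m + 1 - j) x y = 0" if "j \<in> {2..m}" for j
    using assms 2 that by (auto simp: wedge_def)
  then show ?thesis unfolding 2 g_bracket_last by simp
qed (simp add: g_bracket_high)

text \<open>The first derived step removes the abelian torus part; each later step raises the lowest
  possible weight by one, until none is left.\<close>

lemma r_solvable:
  assumes "lie_algebra vscale (g_carrier m) (g_bracket m k q)"
  shows "lie_algebra.solvable r_scale (r_carrier m k q) (r_bracket m k q)"
proof -
  interpret g: lie_algebra vscale "g_carrier m" "g_bracket m k q" by fact
  interpret r: lie_algebra r_scale "r_carrier m k q" "r_bracket m k q"
    by (rule r_lie_algebra[OF assms])
  \<comment> \<open>The upper bound on the support belongs to \<open>V n\<close> so that
    \<open>V (2m + 2)\<close> forces every coordinate to be 0.\<close>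
  define V where "V n = {p :: (cvec \<Rightarrow> cvec) \<times> cvec. fst p = 0 \<and> (\<forall>i. i < n \<or> i > 2 * m + 1 \<longrightarrow> snd p i = 0)}"
    for n :: nat
  have V: "r.subspace (V n)" for n
    by (auto simp: r.subspace_def V_def sd_scale_def vscale_def zero_fun_def)
  have "r.derived_series (Suc n) \<subseteq> V (Suc n)" for n
  proof (induction n)
    case 0
    \<comment> \<open>\<open>V 1\<close> asks only for a zero torus part and a second component in
      the carrier, since coordinate 0 vanishes there.\<close>
    have "r_bracket m k q p p' \<in> V 1" if "p \<in> r_carrier m k q" "p' \<in> r_carrier m k q" for p p'
    proof -
      have "r_bracket m k q p p' \<in> r_carrier m k q" using that r.br_closed by blast
      then have "snd (r_bracket m k q p p') \<in> g_carrier m" by (auto simp: r_carrier_def)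
      moreover have "fst (r_bracket m k q p p') = 0"
        using that t_carrier_commute[OF assms]
        by (auto simp: sd_bracket_def r_carrier_def fun_eq_iff)
      ultimately show ?thesis by (auto simp: V_def g_carrier_def)
    qed
    then have "{r_bracket m k q x y |x y. x \<in> r_carrier m k q \<and> y \<in> r_carrier m k q} \<subseteq> V 1"
      by blast
    then show ?case using r.span_minimal[OF _ V[of 1]] by simp
  next
    case (Suc n)
    have "r_bracket m k q p p' \<in> V (Suc (Suc n))" if "p \<in> V (Suc n)" "p' \<in> V (Suc n)" for p p'
    proof -
      have "snd (r_bracket m k q p p') = g_bracket m k q (snd p) (snd p')"
        "fst (r_bracket m k q p p') = 0"
        using that by (auto simp: sd_bracket_def V_def)
      moreover have "g_bracket m k q (snd p) (snd p') i = 0" if "i < Suc (Suc n)" for i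
        using g_bracket_filtration[of "Suc n" "snd p" "snd p'" i] \<open>p \<in> _\<close> \<open>p' \<in> _\<close> that
        by (auto simp: V_def)
      ultimately show ?thesis by (auto simp: V_def g_bracket_high)
    qed
    then have "{r_bracket m k q x y |x y. x \<in> r.derived_series (Suc n) \<and> y \<in> r.derived_series (Suc n)}
        \<subseteq> V (Suc (Suc n))"
      using Suc.IH by blast
    then show ?case
      using r.span_minimal[OF _ V[of "Suc (Suc n)"]] by (subst r.derived_series.simps(2))
  qed
  from this[of "2 * m + 1"] have "r.derived_series (Suc (2 * m + 1)) \<subseteq> V (Suc (2 * m + 1))" .
  also have "\<dots> \<subseteq> {0}"
    unfolding V_def by (auto simp: prod_eq_iff fun_eq_iff) (metis not_less_eq)
  finally have "r.derived_series (Suc (2 * m + 1)) = {0}"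
    using r.span_zero by fastforce
  then show ?thesis unfolding r.solvable_def by blast
qed

section \<open>Trivial center and inner derivations\<close>

lemma diag_map_of_nat_eq_0:
  assumes "x \<in> g_carrier m" "diag_map m of_nat x = 0"
  shows "x = 0"
proof
  fix i
  \<comment> \<open>Only index 0 has weight 0, and it lies outside the support of carrier
    vectors.\<close>
  have "of_nat i * x i = 0" using assms by (metis diag_map_apply zero_fun_apply)
  then show "x i = 0 i" using assms(1) by (cases "i = 0") (auto simp: g_carrier_def)
qed

lemma t_carrier_eq_0:
  assumes "lie_algebra vscale (g_carrier m) (g_bracket m k q)" and f: "f \<in> t_carrier m k q"
    and "\<And>i. i \<in> {1..2 * m + 1} \<Longrightarrow> f (X_basis i) = 0"
  shows "f = 0"
proof -
  obtain c where c: "f = diag_map m c" using t_carrier_obtain_diag[OF assms(1,2)] .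
  have "c i = 0" if "i \<in> {1..2 * m + 1}" for i
  proof -
    have "vscale (c i) (X_basis i) i = 0"
      using assms(3)[OF that] diag_map_basis[OF that] c by (metis zero_fun_apply)
    then show ?thesis by (simp add: vscale_apply X_basis_def)
  qed
  then show ?thesis
    unfolding c by (auto simp: diag_map_def fun_eq_iff g_carrier_def)
qed

text \<open>Bracketing a central \<open>(f, x)\<close> with \<open>(h, 0)\<close> gives
  \<open>- h x\<close>, so \<open>x = 0\<close>; bracketing with \<open>(0, X_basis i)\<close> then
  shows that \<open>f\<close> kills the basis.\<close>

lemma r_center:
  assumes "lie_algebra vscale (g_carrier m) (g_bracket m k q)"
  shows "lie_algebra.center (r_carrier m k q) (r_bracket m k q) = {0}"
proof -
  interpret g: lie_algebra vscale "g_carrier m" "g_bracket m k q" by fact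
  interpret r: lie_algebra r_scale "r_carrier m k q" "r_bracket m k q"
    by (rule r_lie_algebra[OF assms])
  have t0: "0 \<in> t_carrier m k q" using r.zero_mem unfolding zero_prod_def r_carrier_def by blast
  have "p = 0" if p: "p \<in> r.center" for p
  proof -
    have "p \<in> r_carrier m k q" using p by (simp add: r.center_def)
    then obtain f x where fx: "p = (f, x)" "f \<in> t_carrier m k q" "x \<in> g_carrier m"
      by (auto simp: r_carrier_def)
    have Der: "f \<in> g.Der" using fx unfolding t_carrier_def by blast
    have ctr: "r_bracket m k q p y = 0" if "y \<in> r_carrier m k q" for y
      using p that by (auto simp: r.center_def)
    have "r_bracket m k q p (diag_map m of_nat, 0) = 0"
      using grading_in_t_carrier[OF assms] g.zero_mem by (intro ctr) (auto simp: r_carrier_def)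
    then have "diag_map m of_nat x = 0"
      using fx by (simp add: sd_bracket_def prod_eq_iff g.Der_0[OF Der] g.br_zero_right)
    then have x: "x = 0" using diag_map_of_nat_eq_0 fx by blast
    have "f (X_basis i) = 0" if "i \<in> {1..2 * m + 1}" for i
    proof -
      have "r_bracket m k q p (0, X_basis i) = 0"
        using X_basis_in_g[OF that] t0 by (intro ctr) (auto simp: r_carrier_def)
      then show ?thesis
        using fx X_basis_in_g[OF that] by (simp add: x sd_bracket_def prod_eq_iff g.br_zero_left)
    qed
    then have "f = 0" using t_carrier_eq_0[OF assms fx(2)] by blast
    then show ?thesis using fx x by (simp add: zero_prod_def)
  qed
  moreover have "0 \<in> r.center"
    using r.zero_mem r.br_zero_left by (auto simp: r.center_def)
  ultimately show ?thesis by blast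
qed

text \<open>The assumption \<open>DH\<close> is a normalization. Under it \<open>D\<close> commutes
  with \<open>ad h\<close> up to the diagonal action of the torus element \<open>f\<close>, which
  pins down \<open>D\<close> on each eigenvector of \<open>h\<close>.\<close>

lemma r_derivation_inner_of_grading:
  assumes "lie_algebra vscale (g_carrier m) (g_bracket m k q)"
    and D: "D \<in> lie_algebra.Der r_scale (r_carrier m k q) (r_bracket m k q)"
    and DH: "snd (D (diag_map m of_nat, 0)) = 0"
  obtains g where "g \<in> t_carrier m k q"
    and "\<And>p. p \<in> r_carrier m k q \<Longrightarrow> D p = r_bracket m k q (g, 0) p"
proof -
  interpret g: lie_algebra vscale "g_carrier m" "g_bracket m k q" by fact
  interpret r: lie_algebra r_scale "r_carrier m k q" "r_bracket m k q"
    by (rule r_lie_algebra[OF assms(1)])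
  let ?h = "diag_map m of_nat :: cvec \<Rightarrow> cvec" and ?b = "r_bracket m k q"
  have t0: "0 \<in> t_carrier m k q" using r.zero_mem unfolding zero_prod_def r_carrier_def by blast
  have h: "?h \<in> t_carrier m k q" by (rule grading_in_t_carrier[OF assms(1)])
  have f_0: "f 0 = 0" if "f \<in> t_carrier m k q" for f
    using that g.Der_0 unfolding t_carrier_def by blast
  have in_r: "(f, x) \<in> r_carrier m k q \<longleftrightarrow> f \<in> t_carrier m k q \<and> x \<in> g_carrier m" for f x
    by (simp add: r_carrier_def)
  have br_tg: "?b (f, 0) (g, x) = (0, f x)"
    if "f \<in> t_carrier m k q" "g \<in> t_carrier m k q" "x \<in> g_carrier m" for f g x
    using that t_carrier_commute[OF assms(1)]
    by (auto simp: sd_bracket_def fun_eq_iff f_0 g.br_zero_left)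
  have D_mem: "fst (D p) \<in> t_carrier m k q" "snd (D p) \<in> g_carrier m"
    if "p \<in> r_carrier m k q" for p
    using r.Der_mem[OF D that] by (auto simp: r_carrier_def)
  have H: "(?h, 0) \<in> r_carrier m k q" using h g.zero_mem by (simp add: in_r)
  define f where "f = fst (D (?h, 0))"
  have f: "f \<in> t_carrier m k q" and DH': "D (?h, 0) = (f, 0)"
    using D_mem[OF H] DH by (auto simp: f_def prod_eq_iff)
  obtain \<phi> where \<phi>: "f = diag_map m \<phi>" using t_carrier_obtain_diag[OF assms(1) f] .
  have "\<exists>c. D (0, X_basis i) = (0, vscale c (X_basis i))" if i: "i \<in> {1..2 * m + 1}" for i
  proof -
    note X = X_basis_in_g[OF i]
    have P: "(0, X_basis i) \<in> r_carrier m k q" using X t0 by (simp add: in_r)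
    obtain g v where gv: "D (0, X_basis i) = (g, v)" by fastforce
    have g: "g \<in> t_carrier m k q" and v: "v \<in> g_carrier m" using D_mem[OF P] gv by auto
    have "?b (?h, 0) (0, X_basis i) = (0, vscale (of_nat i) (X_basis i))"
      using br_tg[OF h t0 X] diag_map_basis[OF i] by simp
    also have "\<dots> = r_scale (of_nat i) (0, X_basis i)"
      by (simp add: sd_scale_def fun_eq_iff vscale_def)
    \<comment> \<open>Apply \<open>D\<close> to \<open>[h, X_i] = i X_i\<close> and expand the left
      side by the Leibniz rule.\<close>
    finally have "r_scale (of_nat i) (g, v) = D (?b (?h, 0) (0, X_basis i))"
      using r.Der_scale[OF D P] gv by simp
    also have "\<dots> = ?b (f, 0) (0, X_basis i) + ?b (?h, 0) (g, v)"
      using r.Der_br[OF D H P] DH' gv by simp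
    also have "\<dots> = (0, vscale (\<phi> i) (X_basis i) + ?h v)"
      using br_tg[OF f t0 X] br_tg[OF h g v] diag_map_basis[OF i] \<phi> by simp
    finally have eq: "(\<lambda>z. vscale (of_nat i) (g z)) = 0"
      "vscale (of_nat i) v = vscale (\<phi> i) (X_basis i) + ?h v"
      by (auto simp: sd_scale_def)
    have "g z = 0" for z
      using fun_cong[OF eq(1), of z] i by (auto simp: g.scale_eq_0_iff)
    then have "g = 0" by (simp add: fun_eq_iff)
    \<comment> \<open>For \<open>l \<noteq> i\<close> the equation reads
      \<open>(i - l) v l = 0\<close>, and distinct weights give \<open>v l = 0\<close>.\<close>
    moreover have "v l = vscale (v i) (X_basis i) l" for l
      using fun_cong[OF eq(2), of l] v
      by (cases "l = i") (auto simp: vscale_def X_basis_def diag_map_apply)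
    then have "v = vscale (v i) (X_basis i)" by blast
    ultimately show ?thesis using gv by auto
  qed
  then obtain \<mu> where \<mu>:
    "\<And>i. i \<in> {1..2 * m + 1} \<Longrightarrow> D (0, X_basis i) = (0, vscale (\<mu> i) (X_basis i))"
    by metis
  let ?G = "diag_map m \<mu>"
  have D_g: "D (0, x) = (0, ?G x)" if "x \<in> g_carrier m" for x
    using that
  proof (induction rule: g_carrier_induct)
    case zero
    show ?case using r.Der_0[OF D] diag_map_zero zero_prod_def by metis
  next
    case (basis c i)
    have P: "(0, X_basis i) \<in> r_carrier m k q" using X_basis_in_g[OF basis] t0 by (simp add: in_r)
    have "(0, vscale c (X_basis i)) = r_scale c (0, X_basis i)"
      by (simp add: sd_scale_def fun_eq_iff vscale_def)
    then have "D (0, vscale c (X_basis i)) = r_scale c (0, vscale (\<mu> i) (X_basis i))"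
      using r.Der_scale[OF D P] \<mu>[OF basis] by simp
    also have "\<dots> = (0, vscale c (vscale (\<mu> i) (X_basis i)))"
      by (simp add: sd_scale_def fun_eq_iff vscale_def)
    also have "vscale c (vscale (\<mu> i) (X_basis i)) = ?G (vscale c (X_basis i))"
      using g.scale_mem[OF X_basis_in_g[OF basis]]
      by (auto simp: fun_eq_iff diag_map_apply vscale_apply X_basis_def)
    finally show ?case .
  next
    case (add x y)
    have "D ((0, x) + (0, y)) = D (0, x) + D (0, y)"
      using add(1,2) t0 by (intro r.Der_add[OF D]) (simp_all add: in_r)
    then show ?case
      by (simp only: add.IH add_Pair add_0 diag_map_add[OF add(1,2)])
  qed
  \<comment> \<open>On the second factor \<open>D\<close> acts as \<open>?G\<close>, which therefore
    inherits the Leibniz rule.\<close>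
  have G: "?G \<in> t_carrier m k q"
  proof (rule diag_map_in_t_carrier[OF assms(1)])
    fix x y assume x: "x \<in> g_carrier m" and y: "y \<in> g_carrier m"
    have br_gg: "?b (0, u) (0, v) = (0, g_bracket m k q u v)" for u v
      by (auto simp: sd_bracket_def fun_eq_iff)
    have "(0, ?G (g_bracket m k q x y)) = D (?b (0, x) (0, y))"
      using D_g[OF g.br_closed[OF x y]] by (simp add: br_gg)
    also have "\<dots> = ?b (0, ?G x) (0, y) + ?b (0, x) (0, ?G y)"
      using r.Der_br[OF D, of "(0, x)" "(0, y)"] x y t0 D_g by (simp add: in_r)
    finally show "?G (g_bracket m k q x y) = g_bracket m k q (?G x) y + g_bracket m k q x (?G y)"
      by (simp add: br_gg)
  qed
  have D_t: "D (s, 0) = 0" if s: "s \<in> t_carrier m k q" for s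
  proof -
    obtain \<sigma> where \<sigma>: "s = diag_map m \<sigma>" using t_carrier_obtain_diag[OF assms(1) s] .
    have S: "(s, 0) \<in> r_carrier m k q" using s g.zero_mem by (simp add: in_r)
    obtain g v where gv: "D (s, 0) = (g, v)" by fastforce
    have g: "g \<in> t_carrier m k q" and v: "v \<in> g_carrier m" using D_mem[OF S] gv by auto
    \<comment> \<open>\<open>s\<close> commutes with both \<open>h\<close> and \<open>f\<close>, so
      expanding this bracket under \<open>D\<close> leaves only \<open>h v = 0\<close>.\<close>
    have "D (?b (?h, 0) (s, 0)) = 0"
      using br_tg[OF h s g.zero_mem] f_0[OF h] r.Der_0[OF D] by (simp add: zero_prod_def)
    then have "?b (f, 0) (s, 0) + ?b (?h, 0) (g, v) = 0"
      using r.Der_br[OF D H S] DH' gv by simp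
    then have "?h v = 0"
      using br_tg[OF f s g.zero_mem] f_0[OF f] br_tg[OF h g v] by (simp add: zero_prod_def)
    then have v0: "v = 0" using diag_map_of_nat_eq_0 v by blast
    have "g (X_basis i) = 0" if i: "i \<in> {1..2 * m + 1}" for i
    proof -
      note X = X_basis_in_g[OF i]
      have P: "(0, X_basis i) \<in> r_carrier m k q" using X t0 by (simp add: in_r)
      \<comment> \<open>Evaluate \<open>D [s, X_i]\<close> in two ways; as \<open>s\<close> and
        \<open>?G\<close> commute, the discrepancy is exactly \<open>g (X_basis i)\<close>.\<close>
      have "(0, ?G (s (X_basis i))) = D (?b (s, 0) (0, X_basis i))"
        using br_tg[OF s t0 X] D_g diag_map_mem[of m \<sigma>] \<sigma> by simp
      also have "\<dots> = ?b (g, 0) (0, X_basis i) + ?b (s, 0) (0, ?G (X_basis i))"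
        using r.Der_br[OF D S P] gv v0 D_g[OF X] by simp
      also have "\<dots> = (0, g (X_basis i) + s (?G (X_basis i)))"
        using br_tg[OF g t0 X] br_tg[OF s t0 diag_map_mem] by simp
      finally show ?thesis
        using t_carrier_commute[OF assms(1) s G] by simp
    qed
    then have "g = 0" using t_carrier_eq_0[OF assms(1) g] by blast
    then show ?thesis using gv v0 by (simp add: zero_prod_def)
  qed
  show ?thesis
  proof (rule that[OF G])
    fix p assume "p \<in> r_carrier m k q"
    then obtain s x where p: "p = (s, x)" "s \<in> t_carrier m k q" "x \<in> g_carrier m"
      by (auto simp: r_carrier_def)
    have "D (s, x) = D (s, 0) + D (0, x)"
      using r.Der_add[OF D, of "(s, 0)" "(0, x)"] p t0 g.zero_mem by (simp add: in_r)
    then show "D p = ?b (?G, 0) p"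
      using D_t D_g p br_tg[OF G] by (simp add: zero_prod_def)
  qed
qed

text \<open>Since \<open>[(0, w), (h, 0)] = (0, - h w)\<close> and \<open>h\<close> is invertible on
  the carrier, some \<open>ad (0, w)\<close> matches the second component of
  \<open>D (h, 0)\<close>; subtracting it achieves the normalization.\<close>

lemma r_derivation_inner:
  assumes "lie_algebra vscale (g_carrier m) (g_bracket m k q)"
    and D: "D \<in> lie_algebra.Der r_scale (r_carrier m k q) (r_bracket m k q)"
  shows "lie_algebra.inner_derivation r_scale (r_carrier m k q) (r_bracket m k q) D"
proof -
  interpret g: lie_algebra vscale "g_carrier m" "g_bracket m k q" by fact
  interpret r: lie_algebra r_scale "r_carrier m k q" "r_bracket m k q"
    by (rule r_lie_algebra[OF assms(1)])
  let ?h = "diag_map m of_nat :: cvec \<Rightarrow> cvec" and ?b = "r_bracket m k q"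
  have t0: "0 \<in> t_carrier m k q" using r.zero_mem unfolding zero_prod_def r_carrier_def by blast
  have H: "(?h, 0) \<in> r_carrier m k q"
    using grading_in_t_carrier[OF assms(1)] g.zero_mem by (simp add: r_carrier_def)
  define y where "y = snd (D (?h, 0))"
  have y: "y \<in> g_carrier m" using r.Der_mem[OF D H] by (auto simp: r_carrier_def y_def)
  \<comment> \<open>Solves \<open>- h w = y\<close>; at index 0 division by zero yields 0, as the
    carrier demands.\<close>
  define w :: cvec where "w = (\<lambda>i. - y i / of_nat i)"
  have w: "w \<in> g_carrier m" using y by (auto simp: g_carrier_def w_def)
  have hw: "?h w = - y"
  proof
    fix i show "?h w i = (- y) i"
      using w y by (cases "i = 0") (auto simp: diag_map_apply w_def g_carrier_def)
  qed
  have W: "(0, w) \<in> r_carrier m k q" using w t0 by (simp add: r_carrier_def)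
  define E where "E = (\<lambda>p. D p - (if p \<in> r_carrier m k q then ?b (0, w) p else 0))"
  have E: "E \<in> r.Der" unfolding E_def by (rule r.diff_in_Der[OF D r.ad_in_Der[OF W]])
  have "snd (E (?h, 0)) = 0"
    using H hw w by (simp add: E_def sd_bracket_def g.br_zero_right flip: y_def)
  then obtain g where g: "g \<in> t_carrier m k q"
    and Eg: "\<And>p. p \<in> r_carrier m k q \<Longrightarrow> E p = ?b (g, 0) p"
    using r_derivation_inner_of_grading[OF assms(1) E] by blast
  have G: "(g, 0) \<in> r_carrier m k q" using g g.zero_mem by (simp add: r_carrier_def)
  show ?thesis
  proof (rule r.inner_derivationI[OF D r.add_mem[OF G W]])
    fix p assume p: "p \<in> r_carrier m k q"
    have "D p = ?b (g, 0) p + ?b (0, w) p"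
      using Eg[OF p] p by (simp add: E_def algebra_simps)
    then show "D p = ?b ((g, 0) + (0, w)) p"
      using r.br_add_left[OF G W p] by simp
  qed
qed

text \<open>\<open>lie_algebra.solvable\<close> and \<open>lie_algebra.complete\<close> carry their
  meaning only under the locale axioms, so the conclusion includes these.\<close>

theorem mainTheorem2:
  fixes m k :: nat and q :: "nat \<Rightarrow> nat"
  assumes "m \<ge> 4" and "k \<ge> 1"
    and "strict_mono_on {1..k} q"
    and "\<forall>i\<in>{1..k}. 3 \<le> q i \<and> q i \<le> m + 1"
  shows "lie_algebra r_scale (r_carrier m k q) (r_bracket m k q)
    \<and> lie_algebra.solvable r_scale (r_carrier m k q) (r_bracket m k q)
    \<and> lie_algebra.complete r_scale (r_carrier m k q) (r_bracket m k q)"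
proof -
  have g: "lie_algebra vscale (g_carrier m) (g_bracket m k q)"
    using g_lie_algebra assms by simp
  interpret r: lie_algebra r_scale "r_carrier m k q" "r_bracket m k q"
    by (rule r_lie_algebra[OF g])
  have "r.complete"
    unfolding r.complete_def using r_center[OF g] r_derivation_inner[OF g] by blast
  then show ?thesis
    using r.lie_algebra_axioms r_solvable[OF g] by blast
qed

end
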